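(* Let $G$ be a graph, let $\ell\ge 0$ be an integer, and let $v$ be a vertex of $G$ with degree $\deg(v)$. Then \[ -1\le Z_{(\ell)}(G-v)-Z_{(\ell)}(G)\le \deg(v). \] Moreover, these bounds are tight when $\ell\ge 1$: for every $\ell\ge 1$ there exist a graph $G$ and a vertex $v$ of $G$ with $Z_{(\ell)}(G-v)-Z_{(\ell)}(G)=-1$, and there exist a graph $G$ and a vertex $v$ of $G$ with $Z_{(\ell)}(G-v)-Z_{(\ell)}(G)=\deg(v)$.
   Context: All graphs are finite, simple and undirected. Let $G$ be a graph, $S\subseteq V(G)$ a set of initially blue vertices (all other vertices white), and $L\subseteq V(G)$ a set of leaks. The leaky color change rule: a blue vertex $b\notin L$ which has exactly one white neighbor $w$ may force $w$ to become blue. $S$ is an $\ell$-leaky forcing set if for every choice of a set $L$ of $\ell$ leaks, repeated application of the rule eventually turns all vertices blue (if $\ell>|V(G)|$, this is read with $L=V(G)$). $Z_{(\ell)}(G)$ is the minimum size of an $\ell$-leaky forcing set of $G$; for $\ell=0$ it is the zero forcing number $Z(G)$. $G-v$ denotes the graph obtained from $G$ by deleting $v$ and all edges incident to it. *)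

theory Defs
  imports "Graph_Theory.Digraph"
begin

text \<open>
  A finite simple undirected graph is an instance of the locale \<^locale>\<open>graph\<close>: each edge
  \<open>{u, w}\<close> is represented by the two arcs \<open>(u, w)\<close> and \<open>(w, u)\<close>. The neighbours of \<open>u\<close> are the
  vertices \<open>w\<close> with \<open>u \<rightarrow>\<^bsub>G\<^esub> w\<close>, the degree of \<open>u\<close> is \<^term>\<open>out_degree G u\<close>, and \<open>G - u\<close> is
  \<^term>\<open>pre_digraph.del_vert G u\<close>. The graph without vertices is allowed; it arises as
  \<open>G - v\<close> when \<open>v\<close> is the only vertex of \<open>G\<close>.
\<close>

definition white_nbrs :: "('a, 'b) pre_digraph \<Rightarrow> 'a set \<Rightarrow> 'a \<Rightarrow> 'a set" where
  "white_nbrs G B b = {w. b \<rightarrow>\<^bsub>G\<^esub> w \<and> w \<notin> B}"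

text \<open>One force: \<open>L\<close> is the set of leaks, and the set of blue vertices grows from \<open>B\<close> to \<open>B'\<close>.\<close>

definition leaky_force ::
    "('a, 'b) pre_digraph \<Rightarrow> 'a set \<Rightarrow> 'a set \<Rightarrow> 'a set \<Rightarrow> bool" where
  "leaky_force G L B B' \<longleftrightarrow>
     (\<exists>b w. b \<in> B \<and> b \<notin> L \<and> white_nbrs G B b = {w} \<and> B' = insert w B)"

text \<open>
  ``Eventually all vertices turn blue'' is expressed by the existence of a finite sequence of
  forces. The order of the forces does not matter: a possible force stays possible, or its
  target turns blue, when other vertices turn blue. The minimum in the size of \<open>L\<close> covers
  the case of more leaks than vertices, where \<open>L\<close> is the whole vertex set.
\<close>

definition leaky_forcing_set :: "nat \<Rightarrow> ('a, 'b) pre_digraph \<Rightarrow> 'a set \<Rightarrow> bool" where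
  "leaky_forcing_set l G S \<longleftrightarrow> S \<subseteq> verts G \<and>
     (\<forall>L. L \<subseteq> verts G \<and> card L = min l (card (verts G))
        \<longrightarrow> (leaky_force G L)\<^sup>*\<^sup>* S (verts G))"

text \<open>The minimum is over a nonempty set, since \<^term>\<open>verts G\<close> is a leaky forcing set.\<close>

definition leaky_forcing_number :: "nat \<Rightarrow> ('a, 'b) pre_digraph \<Rightarrow> nat" where
  "leaky_forcing_number l G = (LEAST k. \<exists>S. leaky_forcing_set l G S \<and> card S = k)"

end

theory Submission
  imports Defs
begin

text \<open>
  Both inequalities come from one simulation principle: if every force of one graph is, up to
  vertices that are blue from the start or ignored, also a force of another graph, then a whole
  forcing sequence can be replayed there (\<open>leaky_force_simulation\<close>). A leaky forcing
  set of \<open>G - v\<close> together with \<open>v\<close> forces \<open>G\<close>, since the extra neighbour \<open>v\<close> is never white.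
  Conversely, a leaky forcing set of \<open>G\<close> together with all neighbours of \<open>v\<close> forces \<open>G - v\<close>:
  the forces performed by \<open>v\<close> have become superfluous and the force on \<open>v\<close> is skipped.
  The adversary's choice of exactly \<open>min l (card (verts G))\<close> leaks is first replaced by the choice
  of at most \<open>l\<close> leaks (\<open>leaky_forcing_set_iff\<close>), so that leaks can be transferred between
  \<open>G\<close> and \<open>G - v\<close>, whose numbers of vertices differ.

  For sharpness, lower bounds on the forcing number come from a single observation: a vertex with at
  most \<open>l\<close> neighbours lies in every leaky forcing set, because all its neighbours can be leaks.
  Two isolated vertices give the difference \<open>-1\<close>. For the other bound, take a root with
  \<open>l + 1\<close> children (the hubs), each of which has \<open>l\<close> leaf children. The leaves force everything:
  either some leaf without a leak forces each hub and the hubs outnumber the leaks, so that one of them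
  forces the root; or all \<open>l\<close> leaks sit on the leaves of one hub, and that hub is reached
  through another hub and the root. Without the root every vertex has degree at most
  \<open>l\<close>, so that all of the \<open>l + 1\<close> hubs are needed in addition to the leaves.
\<close>

section \<open>Forcing sequences\<close>

lemma leaky_force_steps_mono:
  assumes "(leaky_force G L)\<^sup>*\<^sup>* S B"
  shows "S \<subseteq> B"
  using assms by (induction rule: rtranclp_induct) (auto simp: leaky_force_def)

lemma (in wf_digraph) leaky_force_steps_in_verts:
  assumes "(leaky_force G L)\<^sup>*\<^sup>* S B" and "S \<subseteq> verts G"
  shows "B \<subseteq> verts G"
  using assms
proof (induction rule: rtranclp_induct)
  case (step B B')
  then obtain b w where "white_nbrs G B b = {w}" "B' = insert w B"
    unfolding leaky_force_def by blast
  moreover from this have "b \<rightarrow>\<^bsub>G\<^esub> w"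
    unfolding white_nbrs_def by blast
  ultimately show ?case
    using step adj_in_verts by auto
qed

text \<open>
  \<open>X\<close> is a set of vertices about which \<open>H\<close> promises nothing. At every step the
  vertices that are blue in \<open>G\<close> and outside \<open>X\<close> are blue in \<open>H\<close>; hence the white neighbours
  in \<open>H\<close> of a forcing vertex \<open>b\<close> are among those in \<open>G\<close>, and either \<open>b\<close> performs the same force
  in \<open>H\<close> or its target is blue there already. Only vertices \<open>b\<close> whose force really
  has to be replayed are constrained; all others may have arbitrary neighbours in \<open>H\<close>.
\<close>

lemma leaky_force_simulation:
  assumes "(leaky_force G L)\<^sup>*\<^sup>* S B" and "S \<subseteq> S' \<union> X"
    and force: "\<And>b w. b \<rightarrow>\<^bsub>G\<^esub> w \<Longrightarrow> b \<notin> L \<Longrightarrow> w \<notin> S' \<union> X \<Longrightarrow> b \<notin> L' \<and> b \<notin> X \<and> b \<rightarrow>\<^bsub>H\<^esub> w"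
    and nbr: "\<And>b w x. b \<rightarrow>\<^bsub>G\<^esub> w \<Longrightarrow> b \<notin> L \<Longrightarrow> w \<notin> S' \<union> X \<Longrightarrow> b \<rightarrow>\<^bsub>H\<^esub> x \<Longrightarrow>
      x \<in> S' \<or> x \<notin> X \<and> b \<rightarrow>\<^bsub>G\<^esub> x"
  shows "\<exists>B'. (leaky_force H L')\<^sup>*\<^sup>* S' B' \<and> B \<subseteq> B' \<union> X"
  using assms(1)
proof (induction rule: rtranclp_induct)
  case base
  then show ?case using assms(2) by blast
next
  case (step B C)
  then obtain B' where B': "(leaky_force H L')\<^sup>*\<^sup>* S' B'" "B \<subseteq> B' \<union> X"
    by blast
  then have S': "S' \<subseteq> B'"
    using leaky_force_steps_mono by blast
  obtain b w where b: "b \<in> B" "b \<notin> L" and w: "white_nbrs G B b = {w}" and C: "C = insert w B"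
    using step.hyps(2) unfolding leaky_force_def by blast
  show ?case
  proof (cases "w \<in> B' \<union> X")
    case True
    then show ?thesis using B' C by blast
  next
    case False
    have Gbw: "b \<rightarrow>\<^bsub>G\<^esub> w" using w unfolding white_nbrs_def by blast
    then have bw: "b \<notin> L'" "b \<notin> X" "b \<rightarrow>\<^bsub>H\<^esub> w"
      using force[of b w] b False S' by blast+
    have "white_nbrs H B' b = {w}"
    proof
      show "white_nbrs H B' b \<subseteq> {w}"
        unfolding w[symmetric] white_nbrs_def using nbr[OF Gbw] b False B'(2) S' by blast
      show "{w} \<subseteq> white_nbrs H B' b"
        using bw(3) False unfolding white_nbrs_def by blast
    qed
    then have "leaky_force H L' B' (insert w B')"
      using b B'(2) bw unfolding leaky_force_def by blast
    then show ?thesis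
      using B' C by (intro exI[of _ "insert w B'"]) auto
  qed
qed

lemma (in wf_digraph) leaky_force_steps_verts_simulation:
  assumes "(leaky_force G' L')\<^sup>*\<^sup>* S' B" and "S' \<subseteq> S \<union> X"
    and "S \<subseteq> verts G" and "verts G - S \<subseteq> B - X"
    and "\<And>b w. b \<rightarrow>\<^bsub>G'\<^esub> w \<Longrightarrow> b \<notin> L' \<Longrightarrow> w \<notin> S \<union> X \<Longrightarrow> b \<notin> L \<and> b \<notin> X \<and> b \<rightarrow>\<^bsub>G\<^esub> w"
    and "\<And>b w x. b \<rightarrow>\<^bsub>G'\<^esub> w \<Longrightarrow> b \<notin> L' \<Longrightarrow> w \<notin> S \<union> X \<Longrightarrow> b \<rightarrow>\<^bsub>G\<^esub> x \<Longrightarrow>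
      x \<in> S \<or> x \<notin> X \<and> b \<rightarrow>\<^bsub>G'\<^esub> x"
  shows "(leaky_force G L)\<^sup>*\<^sup>* S (verts G)"
proof -
  have "\<exists>C. (leaky_force G L)\<^sup>*\<^sup>* S C \<and> B \<subseteq> C \<union> X"
    by (rule leaky_force_simulation[OF assms(1,2)]) (fact assms(5,6))+
  then obtain C where C: "(leaky_force G L)\<^sup>*\<^sup>* S C" "B \<subseteq> C \<union> X" by blast
  moreover have "C = verts G"
    using leaky_force_steps_in_verts[OF C(1) assms(3)] leaky_force_steps_mono[OF C(1)]
      C(2) assms(4) by blast
  ultimately show ?thesis by blast
qed

text \<open>
  To see that a set forces the graph it is enough to rule out stuck colourings; no forcing order
  has to be written down.
\<close>

lemma (in fin_digraph) leaky_force_steps_to_verts: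
  assumes "S \<subseteq> verts G"
    and "\<And>B. S \<subseteq> B \<Longrightarrow> B \<subset> verts G \<Longrightarrow> \<exists>b w. b \<in> B \<and> b \<notin> L \<and> white_nbrs G B b = {w}"
  shows "(leaky_force G L)\<^sup>*\<^sup>* S (verts G)"
  using assms
proof (induction "card (verts G - S)" arbitrary: S rule: less_induct)
  case less
  show ?case
  proof (cases "S = verts G")
    case False
    then obtain b w where b: "b \<in> S" "b \<notin> L" "white_nbrs G S b = {w}"
      using less.prems by blast
    then have w: "w \<in> verts G" "w \<notin> S"
      using adj_in_verts(2)[of b w] unfolding white_nbrs_def by blast+
    have "(leaky_force G L)\<^sup>*\<^sup>* (insert w S) (verts G)"
    proof (rule less.hyps)
      show "card (verts G - insert w S) < card (verts G - S)"
        using w by (intro psubset_card_mono) auto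
    qed (use w less.prems in auto)
    moreover have "leaky_force G L S (insert w S)"
      using b unfolding leaky_force_def by blast
    ultimately show ?thesis by (rule converse_rtranclp_into_rtranclp[rotated])
  qed simp
qed

section \<open>Leaky forcing sets and the leaky forcing number\<close>

text \<open>
  Fewer leaks only make forcing easier, so a smaller set of leaks can be enlarged to one of the
  prescribed size. Stated with an upper bound, the condition on the leaks no longer depends on the
  number of vertices.
\<close>

lemma (in fin_digraph) leaky_forcing_set_iff:
  "leaky_forcing_set l G S \<longleftrightarrow> S \<subseteq> verts G \<and>
     (\<forall>L. L \<subseteq> verts G \<and> card L \<le> l \<longrightarrow> (leaky_force G L)\<^sup>*\<^sup>* S (verts G))"
proof
  assume S: "leaky_forcing_set l G S"
  then have sub: "S \<subseteq> verts G" unfolding leaky_forcing_set_def by blast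
  have "(leaky_force G L)\<^sup>*\<^sup>* S (verts G)" if L: "L \<subseteq> verts G" "card L \<le> l" for L
  proof -
    have "card L \<le> min l (card (verts G))"
      using L by (simp add: card_mono)
    then obtain L' where L': "L \<subseteq> L'" "L' \<subseteq> verts G" "card L' = min l (card (verts G))"
      using exists_subset_between[of L "min l (card (verts G))" "verts G"] L by auto
    then have "(leaky_force G L')\<^sup>*\<^sup>* S (verts G)"
      using S unfolding leaky_forcing_set_def by blast
    then show ?thesis
      by (rule leaky_force_steps_verts_simulation[where X = "{}"]) (use L' sub in auto)
  qed
  with sub show "S \<subseteq> verts G \<and>
     (\<forall>L. L \<subseteq> verts G \<and> card L \<le> l \<longrightarrow> (leaky_force G L)\<^sup>*\<^sup>* S (verts G))" by blast
qed (simp add: leaky_forcing_set_def)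

lemma leaky_forcing_number_le:
  assumes "leaky_forcing_set l G S"
  shows "leaky_forcing_number l G \<le> card S"
  unfolding leaky_forcing_number_def using assms by (intro Least_le) blast

lemma minimum_leaky_forcing_set:
  obtains S where "leaky_forcing_set l G S" "card S = leaky_forcing_number l G"
proof -
  have "leaky_forcing_set l G (verts G)"
    unfolding leaky_forcing_set_def by simp
  then have "\<exists>k S. leaky_forcing_set l G S \<and> card S = k" by blast
  from LeastI_ex[OF this] show thesis
    using that unfolding leaky_forcing_number_def by blast
qed

text \<open>
  With leaks on all in-neighbours of \<open>w\<close>, nothing can ever force \<open>w\<close>.
\<close>

lemma (in fin_digraph) low_degree_in_leaky_forcing_set:
  assumes S: "leaky_forcing_set l G S" and w: "w \<in> verts G"
    and deg: "card {b. b \<rightarrow>\<^bsub>G\<^esub> w} \<le> l"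
  shows "w \<in> S"
proof (rule ccontr)
  assume "w \<notin> S"
  define L where "L = {b. b \<rightarrow>\<^bsub>G\<^esub> w}"
  have "L \<subseteq> verts G"
    using adj_in_verts unfolding L_def by blast
  then have steps: "(leaky_force G L)\<^sup>*\<^sup>* S (verts G)"
    using S deg unfolding leaky_forcing_set_iff L_def by blast
  have "w \<notin> B" if "(leaky_force G L)\<^sup>*\<^sup>* S B" for B
    using that
  proof (induction rule: rtranclp_induct)
    case (step B C)
    then show ?case
      unfolding leaky_force_def L_def white_nbrs_def by blast
  qed fact
  with steps w show False by blast
qed

text \<open>
  A leaky forcing set of vertices of low degree is contained in every other one, hence is minimum.
\<close>

lemma (in fin_digraph) leaky_forcing_number_eq_card:
  assumes "leaky_forcing_set l G S" and "\<And>w. w \<in> S \<Longrightarrow> card {b. b \<rightarrow>\<^bsub>G\<^esub> w} \<le> l"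
  shows "leaky_forcing_number l G = card S"
proof (rule antisym)
  obtain T where T: "leaky_forcing_set l G T" "card T = leaky_forcing_number l G"
    using minimum_leaky_forcing_set .
  have "S \<subseteq> verts G" "T \<subseteq> verts G"
    using assms(1) T(1) unfolding leaky_forcing_set_def by blast+
  moreover from this have "S \<subseteq> T"
    using low_degree_in_leaky_forcing_set[OF T(1)] assms(2) by blast
  moreover from calculation have "finite T"
    using finite_subset finite_verts by metis
  ultimately show "card S \<le> leaky_forcing_number l G"
    using card_mono T(2) by metis
qed (rule leaky_forcing_number_le[OF assms(1)])

lemma (in fin_digraph) leaky_forcing_number_low_degree:
  assumes "\<And>w. w \<in> verts G \<Longrightarrow> card {b. b \<rightarrow>\<^bsub>G\<^esub> w} \<le> l"
  shows "leaky_forcing_number l G = card (verts G)"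
  using assms by (intro leaky_forcing_number_eq_card) (auto simp: leaky_forcing_set_def)

section \<open>Deleting a vertex\<close>

lemma dominates_del_vert:
  "u \<rightarrow>\<^bsub>pre_digraph.del_vert G v\<^esub> w \<longleftrightarrow> u \<rightarrow>\<^bsub>G\<^esub> w \<and> u \<noteq> v \<and> w \<noteq> v"
  unfolding arcs_ends_conv by (auto simp: pre_digraph.del_vert_simps)

lemma head_out_arcs: "head G ` out_arcs G v = {w. v \<rightarrow>\<^bsub>G\<^esub> w}"
  unfolding arcs_ends_conv by auto

lemma (in fin_digraph) card_dominates_le_out_degree:
  "card {w. v \<rightarrow>\<^bsub>G\<^esub> w} \<le> out_degree G v"
  unfolding head_out_arcs[symmetric] out_degree_def
  by (rule card_image_le) (simp add: out_arcs_def)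

text \<open>
  Add \<open>v\<close> to a leaky forcing set of \<open>G - v\<close>: being blue, \<open>v\<close> does not disturb the forces
  of \<open>G - v\<close>.
\<close>

lemma (in fin_digraph) leaky_forcing_number_le_del_vert:
  assumes v: "v \<in> verts G"
  shows "leaky_forcing_number l G \<le> leaky_forcing_number l (del_vert v) + 1"
proof -
  interpret D: fin_digraph "del_vert v" by (rule fin_digraph_del_vert)
  obtain S where S: "leaky_forcing_set l (del_vert v) S"
      "card S = leaky_forcing_number l (del_vert v)"
    using minimum_leaky_forcing_set .
  then have sub: "S \<subseteq> verts G - {v}"
    unfolding leaky_forcing_set_def by (simp add: del_vert_simps)
  have "leaky_forcing_set l G (insert v S)"
    unfolding leaky_forcing_set_iff
  proof (intro conjI allI impI)
    fix L assume L: "L \<subseteq> verts G \<and> card L \<le> l"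
    then have "card (L - {v}) \<le> l"
      by (meson card_Diff1_le order_trans finite_verts rev_finite_subset)
    moreover have "L - {v} \<subseteq> verts (del_vert v)"
      using L by (auto simp: verts_del_vert)
    ultimately have "(leaky_force (del_vert v) (L - {v}))\<^sup>*\<^sup>* S (verts (del_vert v))"
      using S(1) unfolding D.leaky_forcing_set_iff by blast
    then show "(leaky_force G L)\<^sup>*\<^sup>* (insert v S) (verts G)"
      by (rule leaky_force_steps_verts_simulation[where X = "{}"])
        (use sub v in \<open>auto simp: dominates_del_vert del_vert_simps\<close>)
  qed (use sub v in auto)
  then have "leaky_forcing_number l G \<le> card (insert v S)"
    by (rule leaky_forcing_number_le)
  also have "\<dots> \<le> card S + 1"
    by (cases "finite S") (auto simp: card_insert_if)
  finally show ?thesis using S(2) by simp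
qed

text \<open>
  The neighbours of \<open>v\<close> replace \<open>v\<close>: when they are all blue, no force by \<open>v\<close> has to be
  replayed, and the force on \<open>v\<close> is ignored by taking \<open>X = {v}\<close> in the simulation.
\<close>

lemma (in fin_digraph) leaky_forcing_number_del_vert_le:
  assumes no_loop: "\<not> v \<rightarrow>\<^bsub>G\<^esub> v"
  shows "leaky_forcing_number l (del_vert v) \<le> leaky_forcing_number l G + out_degree G v"
proof -
  interpret D: fin_digraph "del_vert v" by (rule fin_digraph_del_vert)
  define N where "N = {w. v \<rightarrow>\<^bsub>G\<^esub> w}"
  obtain S where S: "leaky_forcing_set l G S" "card S = leaky_forcing_number l G"
    using minimum_leaky_forcing_set .
  then have sub: "S \<subseteq> verts G" unfolding leaky_forcing_set_def by blast
  have N: "N \<subseteq> verts G - {v}"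
    using no_loop adj_in_verts unfolding N_def by blast
  have "leaky_forcing_set l (del_vert v) (S - {v} \<union> N)"
    unfolding D.leaky_forcing_set_iff
  proof (intro conjI allI impI)
    fix L assume L: "L \<subseteq> verts (del_vert v) \<and> card L \<le> l"
    then have "(leaky_force G L)\<^sup>*\<^sup>* S (verts G)"
      using S(1) unfolding leaky_forcing_set_iff verts_del_vert by blast
    then show "(leaky_force (del_vert v) L)\<^sup>*\<^sup>* (S - {v} \<union> N) (verts (del_vert v))"
      by (rule D.leaky_force_steps_verts_simulation[where X = "{v}"])
        (use sub N in \<open>auto simp: dominates_del_vert del_vert_simps N_def\<close>)
  qed (use sub N in \<open>auto simp: del_vert_simps\<close>)
  then have "leaky_forcing_number l (del_vert v) \<le> card (S - {v} \<union> N)"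
    by (rule leaky_forcing_number_le)
  also have "\<dots> \<le> card (S - {v}) + card N" by (rule card_Un_le)
  also have "\<dots> \<le> card S + out_degree G v"
    using card_dominates_le_out_degree[of v] sub finite_subset[OF sub]
    unfolding N_def by (intro add_mono card_Diff1_le) auto
  finally show ?thesis using S(2) by simp
qed

section \<open>Sharpness of the bounds\<close>

definition two_points :: "(nat, nat \<times> nat) pre_digraph" where
  "two_points = \<lparr> verts = {0, 1}, arcs = {}, tail = fst, head = snd \<rparr>"

lemma graph_two_points: "graph two_points"
  by unfold_locales (auto simp: two_points_def symmetric_conv)

lemma leaky_forcing_number_two_points:
  "leaky_forcing_number l two_points = 2"
  "leaky_forcing_number l (pre_digraph.del_vert two_points 0) = 1"
proof -
  interpret graph two_points by (rule graph_two_points)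
  interpret D: fin_digraph "del_vert 0" by (rule fin_digraph_del_vert)
  have no_nbrs: "{b. b \<rightarrow>\<^bsub>two_points\<^esub> w} = {}" for w
    unfolding arcs_ends_def two_points_def by simp
  have "leaky_forcing_number l two_points = card (verts two_points)"
    by (rule leaky_forcing_number_low_degree) (simp only: no_nbrs card.empty)
  then show "leaky_forcing_number l two_points = 2" by (simp add: two_points_def)
  have "leaky_forcing_number l (del_vert 0) = card (verts (del_vert 0))"
    using no_nbrs by (intro D.leaky_forcing_number_low_degree) (simp add: dominates_del_vert)
  then show "leaky_forcing_number l (del_vert 0) = 1"
    by (simp add: verts_del_vert) (simp add: two_points_def)
qed

text \<open>
  The tree is laid out on \<open>{..n * n}\<close> with root \<open>n * n\<close>. The numbers below \<open>n * n\<close> fall into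
  \<open>n\<close> blocks of length \<open>n\<close>; the first number of each block, a multiple of \<open>n\<close>, is a hub and
  the other \<open>n - 1\<close> are its leaves.
\<close>

definition hub_parent :: "nat \<Rightarrow> nat \<Rightarrow> nat" where
  "hub_parent n m = (if n dvd m then n * n else n * (m div n))"

definition hub_tree :: "nat \<Rightarrow> (nat, nat \<times> nat) pre_digraph" where
  "hub_tree n = \<lparr> verts = {..n * n},
     arcs = (\<lambda>m. (m, hub_parent n m)) ` {..<n * n} \<union> (\<lambda>m. (hub_parent n m, m)) ` {..<n * n},
     tail = fst, head = snd \<rparr>"

definition hubs :: "nat \<Rightarrow> nat set" where
  "hubs n = {m. m < n * n \<and> n dvd m}"

definition leaves_at :: "nat \<Rightarrow> nat \<Rightarrow> nat set" where
  "leaves_at n h = {m. m < n * n \<and> \<not> n dvd m \<and> hub_parent n m = h}"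

lemma verts_hub_tree: "verts (hub_tree n) = {..n * n}"
  by (simp add: hub_tree_def)

lemma dominates_hub_tree:
  "u \<rightarrow>\<^bsub>hub_tree n\<^esub> w \<longleftrightarrow>
     u < n * n \<and> w = hub_parent n u \<or> w < n * n \<and> u = hub_parent n w"
  unfolding arcs_ends_conv hub_tree_def by force

lemma hub_parent_leaf:
  assumes "m < n * n" "\<not> n dvd m"
  shows "hub_parent n m \<in> hubs n" "hub_parent n m < m"
proof -
  have "n * (m div n) < m"
    using assms(2) times_div_less_eq_dividend[of n m] by (metis dvd_triv_left le_neq_implies_less)
  moreover have "0 < n" "m div n < n"
    using assms(1) less_mult_imp_div_less by (cases n; simp)+
  ultimately show "hub_parent n m \<in> hubs n" "hub_parent n m < m"
    using assms unfolding hubs_def hub_parent_def by auto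
qed

lemma graph_hub_tree: "graph (hub_tree n)"
proof
  fix e assume e: "e \<in> arcs (hub_tree n)"
  have le: "hub_parent n m \<le> n * n" "hub_parent n m \<noteq> m" if "m < n * n" for m
    using hub_parent_leaf[OF that] that by (auto simp: hub_parent_def hubs_def)
  show "tail (hub_tree n) e \<in> verts (hub_tree n)" "head (hub_tree n) e \<in> verts (hub_tree n)"
    using e le(1) by (auto simp: hub_tree_def)
  show "tail (hub_tree n) e \<noteq> head (hub_tree n) e"
    using e le(2) by (auto simp: hub_tree_def dest: sym)
next
  show "symmetric (hub_tree n)"
    unfolding symmetric_def sym_def arcs_ends_conv by (auto simp: hub_tree_def)
qed (auto simp: hub_tree_def arc_to_ends_def)

lemma card_hubs: "card (hubs n) = n"
proof -
  have "hubs n = (*) n ` {..<n}"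
    unfolding hubs_def by (auto elim!: dvdE)
  moreover have "inj_on ((*) n) {..<n}"
    by (auto simp: inj_on_def)
  ultimately show ?thesis by (simp add: card_image)
qed

lemma leaves_at_eq:
  assumes h: "h \<in> hubs n"
  shows "leaves_at n h = {h<..<h + n}"
proof -
  from h obtain i where i: "h = n * i" "i < n"
    unfolding hubs_def by (auto elim!: dvdE)
  have top: "h + n \<le> n * n"
    using i mult_le_mono2[of "Suc i" n n] by simp
  show ?thesis
  proof (intro set_eqI iffI)
    fix m assume "m \<in> leaves_at n h"
    then have m: "\<not> n dvd m" "n * (m div n) = h"
      unfolding leaves_at_def hub_parent_def by auto
    have "m = h + m mod n" using m(2) by (metis mult_div_mod_eq)
    moreover have "m mod n < n" using i by simp
    moreover have "0 < m mod n" using m(1) by (simp add: dvd_eq_mod_eq_0)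
    ultimately show "m \<in> {h<..<h + n}" by simp
  next
    fix m assume "m \<in> {h<..<h + n}"
    then obtain j where j: "m = n * i + j" "0 < j" "j < n"
      using i by (metis greaterThanLessThan_iff less_imp_add_positive nat_add_left_cancel_less)
    then have "\<not> n dvd m" "m div n = i" by (auto simp: dvd_add_right_iff dest: dvd_imp_le)
    then show "m \<in> leaves_at n h"
      using top j i by (auto simp: leaves_at_def hub_parent_def)
  qed
qed

lemma hub_tree_nbrs_leaf:
  assumes "m < n * n" "\<not> n dvd m"
  shows "{w. m \<rightarrow>\<^bsub>hub_tree n\<^esub> w} = {hub_parent n m}"
  using assms by (auto simp: dominates_hub_tree hub_parent_def split: if_splits)

lemma hub_tree_nbrs_hub:
  assumes "h \<in> hubs n"
  shows "{w. h \<rightarrow>\<^bsub>hub_tree n\<^esub> w} = insert (n * n) (leaves_at n h)"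
  using assms by (auto simp: dominates_hub_tree leaves_at_def hubs_def hub_parent_def)

lemma hub_tree_nbrs_root:
  "{w. (n * n) \<rightarrow>\<^bsub>hub_tree n\<^esub> w} = hubs n"
  using hub_parent_leaf(1)[of _ n] by (fastforce simp: dominates_hub_tree hubs_def hub_parent_def)

lemma hub_tree_sym: "u \<rightarrow>\<^bsub>hub_tree n\<^esub> w \<longleftrightarrow> w \<rightarrow>\<^bsub>hub_tree n\<^esub> u"
  by (auto simp: dominates_hub_tree)

lemma hub_tree_vertex_cases:
  assumes "m \<in> verts (hub_tree n)"
  obtains "m = n * n" | "m \<in> hubs n" | "m < n * n" "\<not> n dvd m"
  using assms unfolding hubs_def verts_hub_tree by fastforce

text \<open>
  In a stuck colouring containing the leaves, every white hub has leaks on all of its \<open>l\<close> leaves.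
  If no hub is white, then only the root is, and all \<open>l + 1\<close> hubs would have to be leaks. So some
  hub \<open>h\<close> is white, its leaves use up all the leaks, and the other hubs are blue and not leaks;
  therefore the root is blue, and its only white neighbour is \<open>h\<close>.
\<close>

lemma leaves_hub_tree_forcing:
  fixes l :: nat
  assumes l: "l \<ge> 1"
  defines "n \<equiv> l + 1"
  shows "leaky_forcing_set l (hub_tree n) ({..<n * n} - hubs n)"
proof -
  interpret graph "hub_tree n" by (rule graph_hub_tree)
  let ?S = "{..<n * n} - hubs n"
  have S_iff: "m \<in> ?S \<longleftrightarrow> m < n * n \<and> \<not> n dvd m" for m
    unfolding hubs_def by auto
  show ?thesis
    unfolding leaky_forcing_set_iff
  proof (intro conjI allI impI)
    fix L assume L: "L \<subseteq> verts (hub_tree n) \<and> card L \<le> l"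
    then have finL: "finite L" using finite_subset[OF _ finite_verts] by blast
    show "(leaky_force (hub_tree n) L)\<^sup>*\<^sup>* ?S (verts (hub_tree n))"
    proof (rule leaky_force_steps_to_verts, goal_cases)
      case (2 B)
      show ?case
      proof (rule ccontr)
        assume stuck: "\<not> ?case"
        have leaves: "leaves_at n h \<subseteq> B" for h
          using 2(1) S_iff unfolding leaves_at_def by blast
        have white: "h \<in> hubs n \<Longrightarrow> h \<notin> B \<Longrightarrow> leaves_at n h \<subseteq> L" for h
        proof
          fix m assume h: "h \<in> hubs n" "h \<notin> B" and m: "m \<in> leaves_at n h"
          then have "white_nbrs (hub_tree n) B m = {h}"
            using hub_tree_nbrs_leaf[of m n] unfolding white_nbrs_def leaves_at_def by blast
          then show "m \<in> L" using stuck m leaves by blast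
        qed
        have blue: "h \<in> L" if "h \<in> hubs n" "h \<in> B" "n * n \<notin> B" for h
        proof -
          have "white_nbrs (hub_tree n) B h = {n * n}"
            using hub_tree_nbrs_hub[OF that(1)] leaves[of h] that(3)
            unfolding white_nbrs_def by blast
          then show ?thesis using stuck that by blast
        qed
        have "\<exists>h. h \<in> hubs n \<and> h \<notin> B"
        proof (rule ccontr)
          assume all: "\<not> ?thesis"
          then have "n * n \<notin> B"
            using 2 S_iff by (auto elim!: hub_tree_vertex_cases)
          then have "hubs n \<subseteq> L" using all blue by blast
          then have "n \<le> card L" using card_mono[OF finL] card_hubs[of n] by metis
          then show False using L n_def by simp
        qed
        then obtain h where h: "h \<in> hubs n" "h \<notin> B" by blast
        have "card (leaves_at n h) = l"
          using leaves_at_eq[OF h(1)] n_def by simp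
        then have L_eq: "L = leaves_at n h"
          using white[OF h] L finL by (metis card_seteq)
        have other: "h' \<in> B" if h': "h' \<in> hubs n" "h' \<noteq> h" for h'
        proof (rule ccontr)
          assume "h' \<notin> B"
          then have "leaves_at n h' \<subseteq> leaves_at n h"
            using white h' L_eq by blast
          moreover have "leaves_at n h' \<inter> leaves_at n h = {}"
            using h' unfolding leaves_at_def by blast
          moreover have "h' + 1 \<in> leaves_at n h'"
            using leaves_at_eq[OF h'(1)] l n_def by simp
          ultimately show False by blast
        qed
        have "n * n \<in> B"
        proof (rule ccontr)
          assume "n * n \<notin> B"
          have "\<not> hubs n \<subseteq> {h}"
            using card_hubs[of n] card_mono[of "{h}" "hubs n"] l n_def by auto
          then obtain h' where "h' \<in> hubs n" "h' \<noteq> h" by blast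
          then have "h' \<in> hubs n" "h' \<in> leaves_at n h"
            using other blue \<open>n * n \<notin> B\<close> L_eq by auto
          then show False unfolding hubs_def leaves_at_def by blast
        qed
        moreover have "white_nbrs (hub_tree n) B (n * n) = {h}"
          using hub_tree_nbrs_root[of n] h other unfolding white_nbrs_def by blast
        moreover have "n * n \<notin> L" unfolding L_eq leaves_at_def by simp
        ultimately show False using stuck by blast
      qed
    qed (auto simp: verts_hub_tree)
  qed (auto simp: verts_hub_tree)
qed

lemma leaky_forcing_number_hub_tree:
  fixes l :: nat
  assumes l: "l \<ge> 1"
  defines "n \<equiv> l + 1"
  shows "leaky_forcing_number l (hub_tree n) = n * n - n"
    and "leaky_forcing_number l (pre_digraph.del_vert (hub_tree n) (n * n)) = n * n"
proof -
  interpret graph "hub_tree n" by (rule graph_hub_tree)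
  interpret D: fin_digraph "del_vert (n * n)" by (rule fin_digraph_del_vert)
  have leaf: "card {b. b \<rightarrow>\<^bsub>hub_tree n\<^esub> w} \<le> l" if "w < n * n" "\<not> n dvd w" for w
  proof -
    have "{b. b \<rightarrow>\<^bsub>hub_tree n\<^esub> w} = {hub_parent n w}"
      using hub_tree_nbrs_leaf[OF that] hub_tree_sym by blast
    then show ?thesis using l by simp
  qed
  have sub: "hubs n \<subseteq> {..<n * n}" unfolding hubs_def by auto
  have "leaky_forcing_number l (hub_tree n) = card ({..<n * n} - hubs n)"
    using leaves_hub_tree_forcing[OF l] leaf
    by (intro leaky_forcing_number_eq_card) (auto simp: n_def hubs_def)
  also have "\<dots> = n * n - n"
    using sub card_hubs[of n] by (subst card_Diff_subset) (auto intro: finite_subset)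
  finally show "leaky_forcing_number l (hub_tree n) = n * n - n" .
  have "leaky_forcing_number l (del_vert (n * n)) = card (verts (del_vert (n * n)))"
  proof (rule D.leaky_forcing_number_low_degree)
    fix w assume "w \<in> verts (del_vert (n * n))"
    then have w: "w \<in> verts (hub_tree n)" "w \<noteq> n * n" by (simp_all add: verts_del_vert)
    have nbrs: "{b. b \<rightarrow>\<^bsub>del_vert (n * n)\<^esub> w} = {b. w \<rightarrow>\<^bsub>hub_tree n\<^esub> b} - {n * n}"
      unfolding dominates_del_vert using w(2) hub_tree_sym by blast
    from w(1) show "card {b. b \<rightarrow>\<^bsub>del_vert (n * n)\<^esub> w} \<le> l"
    proof (cases rule: hub_tree_vertex_cases)
      case 2
      then have "{b. b \<rightarrow>\<^bsub>del_vert (n * n)\<^esub> w} = leaves_at n w"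
        unfolding nbrs hub_tree_nbrs_hub[OF 2] leaves_at_def by auto
      then show ?thesis using leaves_at_eq[OF 2] n_def by simp
    next
      case 3
      then show ?thesis
        unfolding nbrs hub_tree_nbrs_leaf[OF 3] using l by (simp add: le_trans[OF card_Diff1_le])
    qed (use w in simp)
  qed
  also have "verts (del_vert (n * n)) = {..<n * n}"
    by (auto simp: verts_del_vert verts_hub_tree)
  finally show "leaky_forcing_number l (del_vert (n * n)) = n * n" by simp
qed

lemma out_degree_hub_tree_root: "out_degree (hub_tree n) (n * n) = n"
proof -
  interpret graph "hub_tree n" by (rule graph_hub_tree)
  have "head (hub_tree n) ` out_arcs (hub_tree n) (n * n) = hubs n"
    by (simp only: head_out_arcs hub_tree_nbrs_root)
  moreover have "inj_on (head (hub_tree n)) (out_arcs (hub_tree n) (n * n))"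
    using no_multi_arcs by (auto simp: inj_on_def arc_to_ends_def)
  ultimately show ?thesis
    unfolding out_degree_def using card_image card_hubs[of n] by metis
qed

theorem theorem5p3:
  shows
    "(\<forall>(G :: ('a, 'b) pre_digraph) (l :: nat) v. graph G \<and> v \<in> verts G \<longrightarrow>
        - 1 \<le> int (leaky_forcing_number l (pre_digraph.del_vert G v))
               - int (leaky_forcing_number l G) \<and>
        int (leaky_forcing_number l (pre_digraph.del_vert G v))
          - int (leaky_forcing_number l G) \<le> int (out_degree G v)) \<and>
     (\<forall>l :: nat. l \<ge> 1 \<longrightarrow>
        (\<exists>(G :: (nat, nat \<times> nat) pre_digraph) v. graph G \<and> v \<in> verts G \<and>
           int (leaky_forcing_number l (pre_digraph.del_vert G v))
             - int (leaky_forcing_number l G) = - 1) \<and>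
        (\<exists>(G :: (nat, nat \<times> nat) pre_digraph) v. graph G \<and> v \<in> verts G \<and>
           int (leaky_forcing_number l (pre_digraph.del_vert G v))
             - int (leaky_forcing_number l G) = int (out_degree G v)))"
proof (intro conjI allI impI; (elim conjE)?)
  fix G :: "('a, 'b) pre_digraph" and l :: nat and v
  assume G: "graph G" and v: "v \<in> verts G"
  interpret graph G by (rule G)
  have "\<not> v \<rightarrow>\<^bsub>G\<^esub> v" using adj_not_same by blast
  from leaky_forcing_number_del_vert_le[OF this, of l]
  show "int (leaky_forcing_number l (del_vert v)) - int (leaky_forcing_number l G)
      \<le> int (out_degree G v)" by simp
  from leaky_forcing_number_le_del_vert[OF v, of l]
  show "- 1 \<le> int (leaky_forcing_number l (del_vert v)) - int (leaky_forcing_number l G)"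
    by simp
next
  fix l :: nat
  show "\<exists>(G :: (nat, nat \<times> nat) pre_digraph) v. graph G \<and> v \<in> verts G \<and>
      int (leaky_forcing_number l (pre_digraph.del_vert G v))
        - int (leaky_forcing_number l G) = - 1"
    by (intro exI[of _ two_points] exI[of _ 0])
      (simp add: leaky_forcing_number_two_points graph_two_points, simp add: two_points_def)
next
  fix l :: nat assume l: "l \<ge> 1"
  let ?n = "l + 1"
  have "int (leaky_forcing_number l (pre_digraph.del_vert (hub_tree ?n) (?n * ?n)))
      - int (leaky_forcing_number l (hub_tree ?n)) = int (out_degree (hub_tree ?n) (?n * ?n))"
    unfolding leaky_forcing_number_hub_tree[OF l] out_degree_hub_tree_root
    by simp
  moreover have "?n * ?n \<in> verts (hub_tree ?n)" by (simp add: verts_hub_tree)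
  ultimately show "\<exists>(G :: (nat, nat \<times> nat) pre_digraph) v. graph G \<and> v \<in> verts G \<and>
      int (leaky_forcing_number l (pre_digraph.del_vert G v))
        - int (leaky_forcing_number l G) = int (out_degree G v)"
    using graph_hub_tree by blast
qed

end
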